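(* Let $p$ be an odd prime, $\zeta=e^{2\pi i/p}$, and let $m,t\ge1$ be integers with $t(p-1)<2m$. Identify $\mathbb R^{2m}$ with $\mathbb C^m$ and let $\mathbb S^{2m-1}=\{\mathbf x\in\mathbb C^m:\|\mathbf x\|=1\}$. If $U_1,\dots,U_{t+1}$ are closed subsets covering $\mathbb S^{2m-1}$, then some $U_i$ contains a full orbit $\{\mathbf x,\zeta\mathbf x,\dots,\zeta^{p-1}\mathbf x\}$ for some $\mathbf x\in\mathbb S^{2m-1}$.
   Context: $\zeta\mathbf x$ denotes multiplication of every complex coordinate of $\mathbf x$ by $\zeta$; this is a free $\mathbb Z_p$-action on $\mathbb S^{2m-1}$. *)

theory Defs
  imports "HOL-Analysis.Analysis"
begin

text \<open>C^m is modelled as complex ^ 'n with m = CARD('n); the sphere S^{2m-1} is the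
unit sphere for the Euclidean (L2) norm of complex ^ 'n.\<close>

definition zeta :: "nat \<Rightarrow> complex" where
  "zeta p = exp (2 * of_real pi * \<i> / of_nat p)"

definition orbit :: "nat \<Rightarrow> complex ^ 'n \<Rightarrow> (complex ^ 'n) set" where
  "orbit p x = {(zeta p ^ k) *s x | k. k < p}"

end

theory Submission
  imports Defs "HOL-Homology.Homology" "HOL-Number_Theory.Cong"
begin

text \<open>Suppose no $U_i$ contains an orbit. Give a point $x$ a label $(i, j)$ with $i \le t$ such that its
orbit meets $U_i$ while $\zeta^{-j}$ keeps a fixed neighbourhood of $x$ away from $U_i$; choose the
labels equivariantly, $\zeta$ acting by $j \mapsto j + 1$ modulo $p$. On a sufficiently small set no
full fibre $\{i\} \times \mathbb{Z}_p$ of labels occurs, so at most $t(p-1)$ labels occur at all.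
Since the homology of the sphere vanishes below dimension $2m - 1 \ge t(p-1)$, there are singular chains
$c_0, \dots, c_{t(p-1)}$ with $\partial c_{k+1} = \zeta c_k - c_k$ for even $k$ and
$\partial c_{k+1} = \sum_i \zeta^i c_k$ for odd $k$, where $c_0$ is a point; subdivision makes their
simplices small. Dually, $\mathbb{Z}_p$ acts freely on the occurring sets of labels, so from
$\alpha_0 = 1$ one obtains alternating cochains $\alpha_k$ on tuples of labels with
$\alpha_{k+1}(c_{k+1}) \equiv \alpha_k(c_k)$ modulo $p$: write $\alpha_k = \beta \circ (\zeta - 1)$ for even $k$
and $\alpha_k = \beta \circ \sum_i \zeta^i$ for odd $k$, and put $\alpha_{k+1} = \delta\beta$. Hence
$\alpha_{t(p-1)}(c_{t(p-1)}) \equiv 1$, although $\alpha_{t(p-1)}$ vanishes on tuples with a repeated label,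
and every tuple of $t(p-1) + 1$ occurring labels has one.\<close>

subsection \<open>Alternating cochains on tuples of labels\<close>

text \<open>The coface map missing \<open>j\<close>: composing a tuple with it deletes entry
  \<open>j\<close>.\<close>

definition skip :: "nat \<Rightarrow> nat \<Rightarrow> nat" where
  "skip j i = (if i < j then i else Suc i)"

definition coboundary :: "nat \<Rightarrow> ((nat \<Rightarrow> 'l) \<Rightarrow> int) \<Rightarrow> (nat \<Rightarrow> 'l) \<Rightarrow> int" where
  "coboundary k \<phi> l = (\<Sum>j\<le>Suc k. (-1) ^ j * \<phi> (l \<circ> skip j))"

text \<open>A tuple of length $k + 1$ is a function on all naturals of which only the entries up to $k$
matter.\<close>

definition alternating :: "nat \<Rightarrow> ((nat \<Rightarrow> 'l) \<Rightarrow> int) \<Rightarrow> bool" where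
  "alternating k \<phi> \<longleftrightarrow>
     (\<forall>l l'. (\<forall>i\<le>k. l i = l' i) \<longrightarrow> \<phi> l = \<phi> l') \<and>
     (\<forall>l. \<forall>i<k. \<phi> (l \<circ> Transposition.transpose i (Suc i)) = - \<phi> l)"

lemma alternating_cong: "alternating k \<phi> \<Longrightarrow> (\<And>i. i \<le> k \<Longrightarrow> l i = l' i) \<Longrightarrow> \<phi> l = \<phi> l'"
  by (auto simp: alternating_def)

lemma alternating_transpose:
  "alternating k \<phi> \<Longrightarrow> i < k \<Longrightarrow> \<phi> (l \<circ> Transposition.transpose i (Suc i)) = - \<phi> l"
  by (auto simp: alternating_def)

text \<open>Induction on the distance \<open>j - i\<close>: an adjacent transposition brings the
  equal entries closer at the cost of a sign. Once they are neighbours it fixes \<open>l\<close>, so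
  the integer \<open>\<phi> l\<close> equals its own negative.\<close>

lemma alternating_eq_0:
  assumes "alternating k \<phi>" "i < j" "j \<le> k" "l i = l j"
  shows "\<phi> l = 0"
  using assms(2-4)
proof (induction "j - i" arbitrary: j l)
  case 0
  then show ?case by simp
next
  case (Suc d)
  show ?case
  proof (cases "j = Suc i")
    case True
    have "l \<circ> Transposition.transpose i (Suc i) = l"
      using Suc.prems True by (auto simp: fun_eq_iff Transposition.transpose_def)
    then have "\<phi> l = - \<phi> l"
      using alternating_transpose[OF assms(1), of i l] Suc.prems True by simp
    then show ?thesis by simp
  next
    case False
    then obtain j' where j': "j = Suc j'" "i < j'"
      using Suc.prems by (metis Suc_lessI less_imp_Suc_add not_less_eq)
    have "\<phi> (l \<circ> Transposition.transpose j' (Suc j')) = 0"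
      by (rule Suc.hyps(1)[of j']) (use Suc j' in \<open>auto simp: Transposition.transpose_def\<close>)
    then show ?thesis
      using alternating_transpose[OF assms(1), of j' l] Suc.prems j' by simp
  qed
qed

lemma alternating_not_inj:
  assumes "alternating k \<phi>" "\<not> inj_on l {..k}"
  shows "\<phi> l = 0"
proof -
  obtain i j where "i \<le> k" "j \<le> k" "i \<noteq> j" "l i = l j"
    using assms(2) by (auto simp: inj_on_def)
  then show ?thesis
    using alternating_eq_0[OF assms(1), of i j l] alternating_eq_0[OF assms(1), of j i l]
    by (cases "i < j") auto
qed

text \<open>The transposition swaps faces \<open>i\<close> and \<open>Suc i\<close>, whose signs in
  the sum are opposite; on every other face it acts as an adjacent transposition, where
  \<open>\<phi>\<close> changes sign.\<close>

lemma alternating_coboundary: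
  assumes "alternating k \<phi>"
  shows "alternating (Suc k) (coboundary k \<phi>)"
  unfolding alternating_def
proof (intro conjI allI impI)
  fix l l' :: "nat \<Rightarrow> 'a"
  assume "\<forall>i\<le>Suc k. l i = l' i"
  then have "\<phi> (l \<circ> skip j) = \<phi> (l' \<circ> skip j)" for j
    by (intro alternating_cong[OF assms]) (auto simp: skip_def)
  then show "coboundary k \<phi> l = coboundary k \<phi> l'"
    by (simp add: coboundary_def)
next
  fix l :: "nat \<Rightarrow> 'a" and i
  assume i: "i < Suc k"
  let ?t = "Transposition.transpose i (Suc i)"
  have "(-1) ^ j * \<phi> (l \<circ> ?t \<circ> skip j) = - ((-1) ^ ?t j * \<phi> (l \<circ> skip (?t j)))"
    if j: "j \<le> Suc k" for j
  proof -
    consider "j < i" | "j = i" | "j = Suc i" | "Suc i < j" by linarith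
    then show ?thesis
    proof cases
      case 1
      then have "l \<circ> ?t \<circ> skip j = (l \<circ> skip j) \<circ> Transposition.transpose (i - 1) (Suc (i - 1))"
        by (auto simp: fun_eq_iff skip_def Transposition.transpose_def less_Suc_eq)
      then show ?thesis
        using alternating_transpose[OF assms, of "i - 1" "l \<circ> skip j"] 1 i by simp
    next
      case 2
      then have "l \<circ> ?t \<circ> skip j = l \<circ> skip (Suc i)"
        by (auto simp: fun_eq_iff skip_def Transposition.transpose_def less_Suc_eq)
      then show ?thesis using 2 by simp
    next
      case 3
      then have "l \<circ> ?t \<circ> skip j = l \<circ> skip i"
        by (auto simp: fun_eq_iff skip_def Transposition.transpose_def less_Suc_eq)
      then show ?thesis using 3 by simp
    next
      case 4
      then have "l \<circ> ?t \<circ> skip j = (l \<circ> skip j) \<circ> ?t"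
        by (auto simp: fun_eq_iff skip_def Transposition.transpose_def less_Suc_eq)
      then show ?thesis
        using alternating_transpose[OF assms, of i "l \<circ> skip j"] 4 j by simp
    qed
  qed
  then have "coboundary k \<phi> (l \<circ> ?t) =
      - (\<Sum>j\<le>Suc k. (-1) ^ ?t j * \<phi> (l \<circ> skip (?t j)))"
    by (simp add: coboundary_def flip: sum_negf)
  also have "(\<Sum>j\<le>Suc k. (-1) ^ ?t j * \<phi> (l \<circ> skip (?t j))) = coboundary k \<phi> l"
    unfolding coboundary_def
    by (rule sum.reindex_bij_betw[of ?t "{..Suc k}" "{..Suc k}" "\<lambda>j. (-1) ^ j * \<phi> (l \<circ> skip j)"])
       (use i in \<open>auto intro!: bij_betw_byWitness[where f' = ?t] simp: Transposition.transpose_def\<close>)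
  finally show "coboundary k \<phi> (l \<circ> ?t) = - coboundary k \<phi> l" .
qed

lemma skip_skip: "j \<le> i \<Longrightarrow> skip j \<circ> skip i = skip (Suc i) \<circ> skip j"
  by (auto simp: skip_def fun_eq_iff)

text \<open>Two entries can be deleted in either order, with opposite signs: \<open>?s\<close>
  matches the index pairs with \<open>j \<le> i\<close> to the remaining pairs, and matched terms
  cancel.\<close>

lemma coboundary_coboundary: "coboundary (Suc k) (coboundary k \<phi>) l = 0"
proof -
  let ?F = "\<lambda>(j, i). (-1) ^ (j + i) * \<phi> (l \<circ> (skip j \<circ> skip i))"
  let ?A = "{(j, i). j \<le> i \<and> i \<le> Suc k}"
  let ?s = "\<lambda>(j, i). (Suc i, j)"
  have fin: "finite ?A"
    by (rule finite_subset[of _ "{..Suc k} \<times> {..Suc k}"]) auto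
  have "coboundary (Suc k) (coboundary k \<phi>) l = (\<Sum>j\<le>Suc (Suc k). \<Sum>i\<le>Suc k. ?F (j, i))"
    unfolding coboundary_def
    by (simp add: sum_distrib_left power_add mult.assoc comp_assoc del: sum.atMost_Suc)
  also have "\<dots> = sum ?F ({..Suc (Suc k)} \<times> {..Suc k})"
    unfolding sum.cartesian_product by (rule sum.cong) auto
  also have "{..Suc (Suc k)} \<times> {..Suc k} = ?A \<union> ?s ` ?A"
  proof -
    have B: "(j, i) \<in> ?s ` ?A" if "i < j" "j \<le> Suc (Suc k)" for i j
      by (rule image_eqI[of _ _ "(i, j - 1)"]) (use that in auto)
    have "x \<in> ?A \<union> ?s ` ?A" if x: "x \<in> {..Suc (Suc k)} \<times> {..Suc k}" for x
    proof (cases "fst x \<le> snd x")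
      case True
      then show ?thesis using x by auto
    next
      case False
      then have "x \<in> ?s ` ?A"
        using x B[of "snd x" "fst x"]
        by (simp only: mem_Times_iff prod.collapse not_le atMost_iff simp_thms)
      then show ?thesis by (rule UnI2)
    qed
    moreover have "?A \<union> ?s ` ?A \<subseteq> {..Suc (Suc k)} \<times> {..Suc k}" by auto
    ultimately show ?thesis by blast
  qed
  also have "sum ?F (?A \<union> ?s ` ?A) = sum ?F ?A + sum ?F (?s ` ?A)"
  proof (rule sum.union_disjoint)
    show "?A \<inter> ?s ` ?A = {}" by auto
  qed (intro finite_imageI fin)+
  also have "sum ?F (?s ` ?A) = (\<Sum>x\<in>?A. ?F (?s x))"
    by (rule sum.reindex_cong[of ?s]) (auto simp: inj_on_def)
  also have "\<dots> = (\<Sum>x\<in>?A. - ?F x)"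
    by (rule sum.cong) (auto simp: skip_skip add.commute)
  finally show ?thesis by (simp only: sum_negf add.right_inverse)
qed

lemma coboundary_comp: "coboundary k \<phi> (T \<circ> l) = coboundary k (\<lambda>l. \<phi> (T \<circ> l)) l"
  by (simp add: coboundary_def comp_assoc)

lemma coboundary_sum: "coboundary k (\<lambda>l. \<Sum>i\<in>I. \<phi> i l) l = (\<Sum>i\<in>I. coboundary k (\<phi> i) l)"
  unfolding coboundary_def sum_distrib_left by (rule sum.swap)

lemma coboundary_diff: "coboundary k (\<lambda>l. \<phi> l - \<psi> l) l = coboundary k \<phi> l - coboundary k \<psi> l"
  by (simp add: coboundary_def right_diff_distrib sum_subtractf del: sum.atMost_Suc)

lemma skip_image: "skip j ` {..k} \<subseteq> {..Suc k}"
  by (auto simp: skip_def)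

subsection \<open>The obstruction cochains of a free action\<close>

text \<open>The valid sets are the simplices of a complex of labels on which \<open>T\<close>
  generates a \<open>Z_p\<close>-action. Freeness enters through \<open>h\<close>, an equivariant
  map to \<open>Z_p\<close> acting on itself by translation.\<close>

locale free_labelling =
  fixes p :: nat and T :: "'l \<Rightarrow> 'l" and valid :: "'l set \<Rightarrow> bool" and h :: "'l set \<Rightarrow> nat"
  assumes valid_image: "valid S \<Longrightarrow> valid (T ` S)"
    and valid_subset: "valid S \<Longrightarrow> S' \<subseteq> S \<Longrightarrow> S' \<noteq> {} \<Longrightarrow> valid S'"
    and T_period: "valid S \<Longrightarrow> x \<in> S \<Longrightarrow> (T ^^ p) x = x"
    and h_less: "valid S \<Longrightarrow> h S < p"
    and h_image: "valid S \<Longrightarrow> h (T ` S) = Suc (h S) mod p"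
begin

lemma valid_funpow: "valid S \<Longrightarrow> valid ((T ^^ n) ` S)"
  by (induction n) (use valid_image in \<open>force simp: image_image\<close>)+

lemma h_funpow: "valid S \<Longrightarrow> h ((T ^^ n) ` S) = (h S + n) mod p"
proof (induction n)
  case 0
  then show ?case using h_less by simp
next
  case (Suc n)
  have "h ((T ^^ Suc n) ` S) = h (T ` ((T ^^ n) ` S))"
    by (simp add: image_comp)
  also have "\<dots> = Suc ((h S + n) mod p) mod p"
    using h_image[OF valid_funpow[OF Suc.prems]] Suc by simp
  finally show ?case by (simp add: mod_Suc_eq)
qed

lemma coboundary_cong:
  assumes "\<And>l. valid (l ` {..k}) \<Longrightarrow> [\<phi> l = \<psi> l] (mod int p)" "valid (l ` {..Suc k})"
  shows "[coboundary k \<phi> l = coboundary k \<psi> l] (mod int p)"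
  unfolding coboundary_def
proof (intro cong_sum cong_mult cong_refl assms(1))
  fix j
  show "valid ((l \<circ> skip j) ` {..k})"
    by (rule valid_subset[OF assms(2)])
       (use skip_image[of j k] in \<open>auto simp: image_comp[symmetric]\<close>)
qed

text \<open>With $n = h(l)$ the tuple $T^{-n} l$ has index $0$, and the definition reads
$\beta(T^n s) = \sum_{i<n} \phi(T^i s)$ on $s = T^{-n} l$; the exponent $p - n + i$ stands for $i - n$.\<close>

definition lift_even :: "nat \<Rightarrow> ((nat \<Rightarrow> 'l) \<Rightarrow> int) \<Rightarrow> (nat \<Rightarrow> 'l) \<Rightarrow> int" where
  "lift_even k \<phi> l = (\<Sum>i<h (l ` {..k}). \<phi> ((T ^^ (p - h (l ` {..k}) + i)) \<circ> l))"

text \<open>The tuples of index \<open>0\<close> represent the orbits, so a sum over an orbit counts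
  the value once.\<close>

definition lift_odd :: "nat \<Rightarrow> ((nat \<Rightarrow> 'l) \<Rightarrow> int) \<Rightarrow> (nat \<Rightarrow> 'l) \<Rightarrow> int" where
  "lift_odd k \<phi> l = (if h (l ` {..k}) = 0 then \<phi> l else 0)"

lemma transpose_image_atMost: "i < k \<Longrightarrow> (l \<circ> Transposition.transpose i (Suc i)) ` {..k} = l ` {..k}"
proof -
  assume "i < k"
  then have "Transposition.transpose i (Suc i) ` {..k} = {..k}"
    by (intro transpose_image_eq) auto
  then show ?thesis by (metis image_comp)
qed

lemma alternating_lift_even:
  assumes "alternating k \<phi>"
  shows "alternating k (lift_even k \<phi>)"
  unfolding alternating_def
proof (intro conjI allI impI)
  fix l l' :: "nat \<Rightarrow> 'l"
  assume eq: "\<forall>i\<le>k. l i = l' i"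
  then have "l ` {..k} = l' ` {..k}" by auto
  moreover have "\<phi> ((T ^^ n) \<circ> l) = \<phi> ((T ^^ n) \<circ> l')" for n
    using eq by (intro alternating_cong[OF assms]) auto
  ultimately show "lift_even k \<phi> l = lift_even k \<phi> l'"
    by (simp add: lift_even_def)
next
  fix l :: "nat \<Rightarrow> 'l" and i
  assume i: "i < k"
  have "\<phi> ((T ^^ n) \<circ> (l \<circ> Transposition.transpose i (Suc i))) = - \<phi> ((T ^^ n) \<circ> l)" for n
    using alternating_transpose[OF assms i, of "(T ^^ n) \<circ> l"] by (simp add: comp_assoc)
  then show "lift_even k \<phi> (l \<circ> Transposition.transpose i (Suc i)) = - lift_even k \<phi> l"
    unfolding lift_even_def transpose_image_atMost[OF i] by (simp add: sum_negf)
qed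

lemma alternating_lift_odd:
  assumes "alternating k \<phi>"
  shows "alternating k (lift_odd k \<phi>)"
  unfolding alternating_def
proof (intro conjI allI impI)
  fix l l' :: "nat \<Rightarrow> 'l"
  assume eq: "\<forall>i\<le>k. l i = l' i"
  then have "l ` {..k} = l' ` {..k}" by auto
  moreover have "\<phi> l = \<phi> l'"
    using eq by (intro alternating_cong[OF assms]) auto
  ultimately show "lift_odd k \<phi> l = lift_odd k \<phi> l'"
    by (simp add: lift_odd_def)
next
  fix l :: "nat \<Rightarrow> 'l" and i
  assume i: "i < k"
  show "lift_odd k \<phi> (l \<circ> Transposition.transpose i (Suc i)) = - lift_odd k \<phi> l"
    unfolding lift_odd_def transpose_image_atMost[OF i]
    using alternating_transpose[OF assms i, of l] by simp
qed

lemma alternating_T_period: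
  assumes "alternating k \<phi>" "valid (l ` {..k})"
  shows "\<phi> ((T ^^ p) \<circ> l) = \<phi> l"
  using T_period[OF assms(2)] by (intro alternating_cong[OF assms(1)]) auto

text \<open>Passing from \<open>l\<close> to \<open>T \<circ> l\<close> lengthens the defining sum
  by one term, which is \<open>\<phi> l\<close> by periodicity. When the index wraps round from
  \<open>p - 1\<close> to \<open>0\<close> the sum becomes empty instead; the lost terms are all
  nontrivial translates, and by \<open>N\<close> they add up to \<open>- \<phi> l\<close>.\<close>

lemma lift_even_diff:
  assumes alt: "alternating k \<phi>" and v: "valid (l ` {..k})"
    and N: "[(\<Sum>i<p. \<phi> ((T ^^ i) \<circ> l)) = 0] (mod int p)"
  shows "[lift_even k \<phi> (T \<circ> l) - lift_even k \<phi> l = \<phi> l] (mod int p)"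
proof -
  define n where "n = h (l ` {..k})"
  have n: "n < p" unfolding n_def by (rule h_less[OF v])
  have hT: "h ((T \<circ> l) ` {..k}) = Suc n mod p"
    using h_image[OF v] by (simp add: n_def image_comp)
  have comm: "(T ^^ m) \<circ> (T \<circ> l) = (T ^^ Suc m) \<circ> l" for m
    by (simp add: fun_eq_iff funpow_swap1)
  show ?thesis
  proof (cases "Suc n < p")
    case True
    then have "lift_even k \<phi> (T \<circ> l) = (\<Sum>i<Suc n. \<phi> ((T ^^ (Suc (p - Suc n + i))) \<circ> l))"
      unfolding lift_even_def hT comm by simp
    also have "\<dots> = (\<Sum>i<Suc n. \<phi> ((T ^^ (p - n + i)) \<circ> l))"
    proof (rule sum.cong)
      fix i
      have "Suc (p - Suc n + i) = p - n + i" using n by simp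
      then show "\<phi> ((T ^^ Suc (p - Suc n + i)) \<circ> l) = \<phi> ((T ^^ (p - n + i)) \<circ> l)" by metis
    qed simp
    also have "\<dots> = lift_even k \<phi> l + \<phi> ((T ^^ p) \<circ> l)"
      using n by (simp add: lift_even_def n_def)
    finally show ?thesis
      using alternating_T_period[OF alt v] by simp
  next
    case False
    then have p: "p = Suc n" using n by simp
    have "lift_even k \<phi> (T \<circ> l) = 0"
      unfolding lift_even_def hT by (simp flip: p)
    moreover have "lift_even k \<phi> l = (\<Sum>i<n. \<phi> ((T ^^ Suc i) \<circ> l))"
      unfolding lift_even_def n_def[symmetric] using n p by simp
    moreover have "(\<Sum>i<p. \<phi> ((T ^^ i) \<circ> l)) = \<phi> l + (\<Sum>i<n. \<phi> ((T ^^ Suc i) \<circ> l))"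
      by (simp only: p sum.lessThan_Suc_shift) (simp add: comp_def)
    ultimately have "\<phi> l - (lift_even k \<phi> (T \<circ> l) - lift_even k \<phi> l) = (\<Sum>i<p. \<phi> ((T ^^ i) \<circ> l))"
      by simp
    then show ?thesis
      using N by (metis cong_diff_iff_cong_0 cong_sym)
  qed
qed

text \<open>Exactly one translate of \<open>l\<close> has index \<open>0\<close>, and
  \<open>\<phi>\<close> agrees modulo \<open>p\<close> on all translates.\<close>

lemma lift_odd_sum:
  assumes v: "valid (l ` {..k})"
    and inv: "\<And>l. valid (l ` {..k}) \<Longrightarrow> [\<phi> (T \<circ> l) = \<phi> l] (mod int p)"
  shows "[(\<Sum>i<p. lift_odd k \<phi> ((T ^^ i) \<circ> l)) = \<phi> l] (mod int p)"
proof -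
  define n where "n = h (l ` {..k})"
  have n: "n < p" unfolding n_def by (rule h_less[OF v])
  have hi: "h (((T ^^ i) \<circ> l) ` {..k}) = (n + i) mod p" for i
    using h_funpow[OF v, of i] by (simp add: n_def image_comp)
  \<comment> \<open>This is \<open>- n\<close> modulo \<open>p\<close>; the outer \<open>mod\<close>
    covers \<open>n = 0\<close>.\<close>
  define m where "m = (p - n) mod p"
  have m: "m < p" using n by (simp add: m_def)
  have m_iff: "(n + i) mod p = 0 \<longleftrightarrow> i = m" if "i < p" for i
  proof (cases "n = 0")
    case True
    then show ?thesis using that by (simp add: m_def)
  next
    case False
    then have "(n + i) mod p = 0 \<longleftrightarrow> n + i = p"
      using that n by (cases "n + i < p") (auto simp: mod_if)
    then show ?thesis using False n by (auto simp: m_def)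
  qed
  have "(\<Sum>i<p. lift_odd k \<phi> ((T ^^ i) \<circ> l)) = (\<Sum>i<p. if i = m then \<phi> ((T ^^ i) \<circ> l) else 0)"
    by (rule sum.cong) (simp_all only: lift_odd_def hi m_iff lessThan_iff)
  also have "\<dots> = \<phi> ((T ^^ m) \<circ> l)"
    using m by simp
  finally have eq: "(\<Sum>i<p. lift_odd k \<phi> ((T ^^ i) \<circ> l)) = \<phi> ((T ^^ m) \<circ> l)" .
  have "[\<phi> ((T ^^ i) \<circ> l) = \<phi> l] (mod int p)" for i
  proof (induction i)
    case 0
    then show ?case by (simp add: comp_def)
  next
    case (Suc i)
    have "valid (((T ^^ i) \<circ> l) ` {..k})"
      using valid_funpow[OF v, of i] by (simp add: image_comp)
    from inv[OF this] Suc show ?case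
      unfolding funpow.simps comp_assoc by (rule cong_trans)
  qed
  then show ?thesis by (simp add: eq)
qed

text \<open>Dimension shifting: divide by \<open>T - 1\<close> or by the orbit sum, then take the
  coboundary. The formulas make sense on all tuples, but the division is justified only modulo
  \<open>p\<close> and on valid ones.\<close>

fun obstruction :: "nat \<Rightarrow> (nat \<Rightarrow> 'l) \<Rightarrow> int" where
  "obstruction 0 = (\<lambda>_. 1)"
| "obstruction (Suc k) =
     coboundary k (if even k then lift_even k (obstruction k) else lift_odd k (obstruction k))"

lemma alternating_obstruction: "alternating k (obstruction k)"
proof (induction k)
  case 0
  then show ?case by (simp add: alternating_def)
next
  case (Suc k)
  then show ?case
    by (simp add: alternating_coboundary alternating_lift_even alternating_lift_odd)
qed

lemma coboundary_obstruction: "coboundary k (obstruction k) l = 0"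
  by (cases k) (simp add: coboundary_def, simp add: coboundary_coboundary)

text \<open>These are the conditions under which the two lifts exist. They reproduce themselves: the
  coboundary commutes with \<open>T\<close>, so \<open>T - 1\<close> or the orbit sum turns the new
  cochain into the coboundary of the old one, which is zero. In degree \<open>0\<close> the orbit
  sum is \<open>p\<close>.\<close>

lemma obstruction_invariance:
  assumes "valid (l ` {..k})"
  shows "even k \<Longrightarrow> [(\<Sum>i<p. obstruction k ((T ^^ i) \<circ> l)) = 0] (mod int p)"
    and "odd k \<Longrightarrow> [obstruction k (T \<circ> l) = obstruction k l] (mod int p)"
proof -
  have "(even k \<longrightarrow> [(\<Sum>i<p. obstruction k ((T ^^ i) \<circ> l)) = 0] (mod int p)) \<and>
    (odd k \<longrightarrow> [obstruction k (T \<circ> l) = obstruction k l] (mod int p))"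
    using assms
  proof (induction k arbitrary: l)
    case 0
    then show ?case by (simp add: cong_def)
  next
    case (Suc k)
    show ?case
    proof (cases "even k")
      case True
      let ?b = "lift_even k (obstruction k)"
      have "[coboundary k (\<lambda>l. ?b (T \<circ> l) - ?b l) l = coboundary k (obstruction k) l] (mod int p)"
        by (intro coboundary_cong[OF _ Suc.prems] lift_even_diff alternating_obstruction)
           (use Suc.IH True in blast)+
      then have "[coboundary k ?b (T \<circ> l) - coboundary k ?b l = 0] (mod int p)"
        by (simp add: coboundary_diff coboundary_comp coboundary_obstruction)
      then show ?thesis
        unfolding obstruction.simps using True by (simp only: cong_diff_iff_cong_0 if_True even_Suc simp_thms)
    next
      case False
      let ?b = "lift_odd k (obstruction k)"
      have "[coboundary k (\<lambda>l. \<Sum>i<p. ?b ((T ^^ i) \<circ> l)) l = coboundary k (obstruction k) l]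
          (mod int p)"
        by (intro coboundary_cong[OF _ Suc.prems] lift_odd_sum) (use Suc.IH False in blast)+
      then show ?thesis
        unfolding coboundary_sum obstruction.simps coboundary_comp coboundary_obstruction
        using False by (simp only: if_False even_Suc simp_thms)
    qed
  qed
  then show "even k \<Longrightarrow> [(\<Sum>i<p. obstruction k ((T ^^ i) \<circ> l)) = 0] (mod int p)"
    and "odd k \<Longrightarrow> [obstruction k (T \<circ> l) = obstruction k l] (mod int p)" by auto
qed

end

subsection \<open>Pairing cochains with singular chains\<close>

definition chain_eval :: "('b \<Rightarrow> int) \<Rightarrow> ('b \<Rightarrow>\<^sub>0 int) \<Rightarrow> int" where
  "chain_eval \<phi> c = (\<Sum>f\<in>Poly_Mapping.keys c. Poly_Mapping.lookup c f * \<phi> f)"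

lemma chain_eval_superset:
  assumes "finite A" "Poly_Mapping.keys c \<subseteq> A"
  shows "chain_eval \<phi> c = (\<Sum>f\<in>A. Poly_Mapping.lookup c f * \<phi> f)"
  unfolding chain_eval_def
  by (rule sum.mono_neutral_left) (use assms in \<open>auto simp: in_keys_iff\<close>)

lemma chain_eval_0 [simp]: "chain_eval \<phi> 0 = 0"
  by (simp add: chain_eval_def)

lemma chain_eval_frag_of [simp]: "chain_eval \<phi> (frag_of f) = \<phi> f"
  by (simp add: chain_eval_def)

lemma chain_eval_add: "chain_eval \<phi> (a + b) = chain_eval \<phi> a + chain_eval \<phi> b"
proof -
  let ?A = "Poly_Mapping.keys a \<union> Poly_Mapping.keys b"
  have "chain_eval \<phi> c = (\<Sum>f\<in>?A. Poly_Mapping.lookup c f * \<phi> f)" if "c \<in> {a, b, a + b}" for c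
    by (rule chain_eval_superset) (use that Poly_Mapping.keys_add[of a b] in auto)
  then show ?thesis
    by (simp add: lookup_add distrib_right sum.distrib)
qed

lemma chain_eval_minus: "chain_eval \<phi> (- a) = - chain_eval \<phi> a"
  using chain_eval_add[of \<phi> a "- a"] by simp

lemma chain_eval_diff: "chain_eval \<phi> (a - b) = chain_eval \<phi> a - chain_eval \<phi> b"
  using chain_eval_add[of \<phi> a "- b"] by (simp add: chain_eval_minus)

lemma chain_eval_sum: "chain_eval \<phi> (\<Sum>i\<in>I. c i) = (\<Sum>i\<in>I. chain_eval \<phi> (c i))"
  by (induction I rule: infinite_finite_induct) (simp_all add: chain_eval_add)

lemma chain_eval_cmul: "chain_eval \<phi> (frag_cmul n a) = n * chain_eval \<phi> a"
  by (subst chain_eval_superset[of "Poly_Mapping.keys a"])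
     (auto simp: chain_eval_def sum_distrib_left mult.assoc dest: subsetD[OF keys_cmul])

lemma chain_eval_cong:
  assumes "\<And>f. f \<in> Poly_Mapping.keys c \<Longrightarrow> [\<phi> f = \<psi> f] (mod m)"
  shows "[chain_eval \<phi> c = chain_eval \<psi> c] (mod m)"
  unfolding chain_eval_def by (intro cong_sum cong_mult cong_refl assms)

lemma chain_eval_diff_fun: "chain_eval (\<lambda>f. \<phi> f - \<psi> f) c = chain_eval \<phi> c - chain_eval \<psi> c"
  by (simp add: chain_eval_def right_diff_distrib sum_subtractf)

lemma chain_eval_sum_fun: "chain_eval (\<lambda>f. \<Sum>i\<in>I. \<phi> i f) c = (\<Sum>i\<in>I. chain_eval (\<phi> i) c)"
  unfolding chain_eval_def sum_distrib_left by (rule sum.swap)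

text \<open>The argument of \<open>f\<close> is vertex \<open>i\<close> of the standard simplex; on
  a simplex of dimension \<open>k\<close> only entries \<open>i \<le> k\<close> are
  meaningful.\<close>

definition vertex_labels :: "('a \<Rightarrow> 'l) \<Rightarrow> ((nat \<Rightarrow> real) \<Rightarrow> 'a) \<Rightarrow> nat \<Rightarrow> 'l" where
  "vertex_labels L f i = L (f (\<lambda>j. if j = i then 1 else 0))"

lemma vertex_labels_face:
  assumes "i \<le> k"
  shows "vertex_labels L (singular_face (Suc k) j f) i = (vertex_labels L f \<circ> skip j) i"
proof -
  have "simplical_face j (\<lambda>n. if n = i then 1 else 0 :: real) = (\<lambda>n. if n = skip j i then 1 else 0)"
    by (auto simp: simplical_face_def skip_def fun_eq_iff)
  then show ?thesis
    using assms by (simp add: vertex_labels_def singular_face_def)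
qed

text \<open>Stokes' formula: face \<open>j\<close> of a simplex carries the label tuple with entry
  \<open>j\<close> deleted.\<close>

lemma chain_eval_boundary:
  assumes "alternating k \<phi>"
  shows "chain_eval (\<lambda>f. \<phi> (vertex_labels L f)) (chain_boundary (Suc k) c) =
    chain_eval (\<lambda>f. coboundary k \<phi> (vertex_labels L f)) c"
  using subset_UNIV
proof (induction c rule: frag_induction)
  case (one f)
  have "\<phi> (vertex_labels L (singular_face (Suc k) j f)) = \<phi> (vertex_labels L f \<circ> skip j)" for j
    by (rule alternating_cong[OF assms]) (rule vertex_labels_face)
  then show ?case
    by (simp add: chain_boundary_of chain_eval_sum chain_eval_cmul coboundary_def
        del: sum.atMost_Suc)
qed (auto simp: chain_boundary_diff chain_eval_diff)

lemma chain_eval_chain_map: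
  assumes c: "singular_chain k X c" and alt: "alternating k \<phi>"
    and equiv: "\<And>x. x \<in> topspace X \<Longrightarrow> L (g x) = T (L x)"
  shows "chain_eval (\<lambda>f. \<phi> (vertex_labels L f)) (chain_map k g c) =
    chain_eval (\<lambda>f. \<phi> (T \<circ> vertex_labels L f)) c"
  using c unfolding singular_chain_def
proof (induction c rule: frag_induction)
  case (one f)
  then have f: "singular_simplex k X f" by simp
  have "vertex_labels L (simplex_map k g f) i = (T \<circ> vertex_labels L f) i" if "i \<le> k" for i
  proof -
    let ?e = "\<lambda>j. if j = i then 1 else 0 :: real"
    have e: "?e \<in> standard_simplex k" using that by simp
    then have "f ?e \<in> topspace X"
      using f by (auto simp: singular_simplex_def continuous_map_def)
    then show ?thesis
      using e by (simp add: vertex_labels_def simplex_map_def equiv)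
  qed
  then have "\<phi> (vertex_labels L (simplex_map k g f)) = \<phi> (T \<circ> vertex_labels L f)"
    by (rule alternating_cong[OF alt])
  then show ?case by (simp only: chain_map_of chain_eval_frag_of)
qed (auto simp: chain_map_diff chain_eval_diff)

definition orbit_step :: "nat \<Rightarrow> ('a \<Rightarrow> 'a) \<Rightarrow> nat \<Rightarrow> 'a chain \<Rightarrow> 'a chain" where
  "orbit_step p g k c =
     (if even k then chain_map k g c - c else (\<Sum>i<p. chain_map k (g ^^ i) c))"

text \<open>The image in the singular complex of the first $D + 1$ terms of the periodic resolution of
$\mathbb{Z}$ over $\mathbb{Z}[\mathbb{Z}_p]$.\<close>

definition resolution :: "nat \<Rightarrow> ('a \<Rightarrow> 'a) \<Rightarrow> 'a topology \<Rightarrow> nat \<Rightarrow> (nat \<Rightarrow> 'a chain) \<Rightarrow> bool" where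
  "resolution p g X D c \<longleftrightarrow> (\<forall>k\<le>D. singular_chain k X (c k)) \<and>
     (\<forall>k<D. chain_boundary (Suc k) (c (Suc k)) = orbit_step p g k (c k)) \<and>
     chain_eval (\<lambda>_. 1) (c 0) = 1"

lemma continuous_map_funpow: "continuous_map X X g \<Longrightarrow> continuous_map X X (g ^^ n)"
  by (induction n) (auto intro: continuous_map_compose)

context free_labelling
begin

text \<open>The value is carried down one degree at a time: \<open>obstruction (Suc k)\<close> is
  the coboundary of \<open>\<beta>\<close>, Stokes moves it to the boundary
  \<open>orbit_step p g k (c k)\<close>, and equivariance of \<open>L\<close> moves the orbit step
  onto \<open>\<beta>\<close>, which returns \<open>obstruction k\<close> modulo \<open>p\<close>.
  Degree \<open>0\<close> is the augmentation.\<close>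

lemma resolution_eval:
  assumes res: "resolution p g X D c"
    and cont: "continuous_map X X g"
    and equiv: "\<And>x. x \<in> topspace X \<Longrightarrow> L (g x) = T (L x)"
    and small: "\<And>k f. k \<le> D \<Longrightarrow> f \<in> Poly_Mapping.keys (c k) \<Longrightarrow> valid (vertex_labels L f ` {..k})"
    and "k \<le> D"
  shows "[chain_eval (\<lambda>f. obstruction k (vertex_labels L f)) (c k) = 1] (mod int p)"
  using \<open>k \<le> D\<close>
proof (induction k)
  case 0
  then show ?case using res by (simp add: resolution_def)
next
  case (Suc k)
  note sc = res[unfolded resolution_def, THEN conjunct1, rule_format, of k]
  have bd: "chain_boundary (Suc k) (c (Suc k)) = orbit_step p g k (c k)"
    using res Suc.prems by (simp add: resolution_def)
  have sck: "singular_chain k X (c k)" using sc Suc.prems by simp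
  have v: "valid (vertex_labels L f ` {..k})" if "f \<in> Poly_Mapping.keys (c k)" for f
    using small[of k f] that Suc.prems by simp
  define \<beta> where "\<beta> = (if even k then lift_even k (obstruction k) else lift_odd k (obstruction k))"
  have alt: "alternating k \<beta>"
    by (simp add: \<beta>_def alternating_lift_even alternating_lift_odd alternating_obstruction)
  have "chain_eval (\<lambda>f. obstruction (Suc k) (vertex_labels L f)) (c (Suc k)) =
      chain_eval (\<lambda>f. coboundary k \<beta> (vertex_labels L f)) (c (Suc k))"
    by (simp add: \<beta>_def)
  also have "\<dots> = chain_eval (\<lambda>f. \<beta> (vertex_labels L f)) (orbit_step p g k (c k))"
    by (simp add: chain_eval_boundary[OF alt] flip: bd)
  finally have eq: "chain_eval (\<lambda>f. obstruction (Suc k) (vertex_labels L f)) (c (Suc k)) = \<dots>" .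
  have "[chain_eval (\<lambda>f. \<beta> (vertex_labels L f)) (orbit_step p g k (c k)) =
      chain_eval (\<lambda>f. obstruction k (vertex_labels L f)) (c k)] (mod int p)"
  proof (cases "even k")
    case True
    have "chain_eval (\<lambda>f. \<beta> (vertex_labels L f)) (orbit_step p g k (c k)) =
        chain_eval (\<lambda>f. \<beta> (T \<circ> vertex_labels L f) - \<beta> (vertex_labels L f)) (c k)"
      using True chain_eval_chain_map[OF sck alt, of L g T] equiv
      by (simp add: orbit_step_def chain_eval_diff chain_eval_diff_fun)
    moreover have "[chain_eval (\<lambda>f. \<beta> (T \<circ> vertex_labels L f) - \<beta> (vertex_labels L f)) (c k) =
      chain_eval (\<lambda>f. obstruction k (vertex_labels L f)) (c k)] (mod int p)"
    proof (rule chain_eval_cong)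
      fix f assume "f \<in> Poly_Mapping.keys (c k)"
      note vf = v[OF this]
      show "[\<beta> (T \<circ> vertex_labels L f) - \<beta> (vertex_labels L f) = obstruction k (vertex_labels L f)]
          (mod int p)"
        using lift_even_diff[OF alternating_obstruction vf obstruction_invariance(1)[OF vf True]] True
        by (simp only: \<beta>_def if_True)
    qed
    ultimately show ?thesis by simp
  next
    case False
    have topsp: "(g ^^ i) x \<in> topspace X" if "x \<in> topspace X" for i x
      using continuous_map_funpow[OF cont, of i] that by (auto simp: continuous_map_def)
    have equivn: "L ((g ^^ i) x) = (T ^^ i) (L x)" if "x \<in> topspace X" for i x
      by (induction i) (simp_all add: equiv topsp that)
    have "chain_eval (\<lambda>f. \<beta> (vertex_labels L f)) (chain_map k (g ^^ i) (c k)) =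
        chain_eval (\<lambda>f. \<beta> ((T ^^ i) \<circ> vertex_labels L f)) (c k)" for i
      by (rule chain_eval_chain_map[OF sck alt, where g = "g ^^ i" and T = "T ^^ i"]) (rule equivn)
    then have "chain_eval (\<lambda>f. \<beta> (vertex_labels L f)) (orbit_step p g k (c k)) =
        chain_eval (\<lambda>f. \<Sum>i<p. \<beta> ((T ^^ i) \<circ> vertex_labels L f)) (c k)"
      using False by (simp add: orbit_step_def chain_eval_sum chain_eval_sum_fun)
    moreover have "[chain_eval (\<lambda>f. \<Sum>i<p. \<beta> ((T ^^ i) \<circ> vertex_labels L f)) (c k) =
      chain_eval (\<lambda>f. obstruction k (vertex_labels L f)) (c k)] (mod int p)"
    proof (rule chain_eval_cong)
      fix f assume "f \<in> Poly_Mapping.keys (c k)"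
      note vf = v[OF this]
      show "[(\<Sum>i<p. \<beta> ((T ^^ i) \<circ> vertex_labels L f)) = obstruction k (vertex_labels L f)]
          (mod int p)"
        using lift_odd_sum[where \<phi> = "obstruction k", OF vf obstruction_invariance(2)[OF _ False]] False
        by (simp only: \<beta>_def if_False)
    qed
    ultimately show ?thesis by simp
  qed
  then show ?case
    unfolding eq by (rule cong_trans) (use Suc in simp)
qed

text \<open>A top simplex has \<open>D + 1\<close> vertices but at most \<open>D\<close> labels, so
  a label repeats and the alternating cochain vanishes; yet \<open>resolution_eval\<close> gives
  \<open>1\<close>.\<close>

lemma no_small_resolution:
  assumes p: "1 < p"
    and res: "resolution p g X D c"
    and cont: "continuous_map X X g"
    and equiv: "\<And>x. x \<in> topspace X \<Longrightarrow> L (g x) = T (L x)"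
    and small: "\<And>k f. k \<le> D \<Longrightarrow> f \<in> Poly_Mapping.keys (c k) \<Longrightarrow> valid (vertex_labels L f ` {..k})"
    and dim: "\<And>S. valid S \<Longrightarrow> card S \<le> D"
  shows False
proof -
  have "obstruction D (vertex_labels L f) = 0" if "f \<in> Poly_Mapping.keys (c D)" for f
  proof (rule alternating_not_inj[OF alternating_obstruction])
    show "\<not> inj_on (vertex_labels L f) {..D}"
      using dim[OF small[OF order_refl that]] by (auto dest: card_image)
  qed
  then have "chain_eval (\<lambda>f. obstruction D (vertex_labels L f)) (c D) = 0"
    by (simp add: chain_eval_def)
  then have "[0 = 1] (mod int p)"
    using resolution_eval[OF res cont equiv small order_refl] by simp
  then show False
    using p by (simp add: cong_def)
qed

end

text \<open>With \<open>N\<close> the sum of the powers of \<open>g\<close>, these are the relations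
  \<open>N (g - 1) = 0\<close> and \<open>(g - 1) N = 0\<close> on chains; both telescope to
  \<open>g ^^ p\<close> minus the identity.\<close>

lemma orbit_step_sum_diff:
  assumes "singular_chain k X c" "\<And>x. x \<in> topspace X \<Longrightarrow> (g ^^ p) x = x"
  shows "(\<Sum>i<p. chain_map k (g ^^ i) (chain_map k g c - c)) = 0"
    and "chain_map k g (\<Sum>i<p. chain_map k (g ^^ i) c) = (\<Sum>i<p. chain_map k (g ^^ i) c)"
proof -
  let ?a = "\<lambda>i. chain_map k (g ^^ i) c"
  have "?a 0 = c" "?a p = c"
    using chain_map_id_gen[OF assms(1), of id] chain_map_id_gen[OF assms(1), of "g ^^ p"] assms(2)
    by auto
  then have a: "?a 0 = ?a p" by simp
  have r: "chain_map k (g ^^ i) (chain_map k g c) = ?a (Suc i)" for i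
    using chain_map_compose[of k "g ^^ i" g] by (simp only: funpow_Suc_right comp_apply)
  have "(\<Sum>i<p. chain_map k (g ^^ i) (chain_map k g c - c)) = (\<Sum>i<p. ?a (Suc i) - ?a i)"
    by (simp only: chain_map_diff r)
  also have "\<dots> = ?a p - ?a 0"
    by (rule sum_lessThan_telescope)
  finally show "(\<Sum>i<p. chain_map k (g ^^ i) (chain_map k g c - c)) = 0"
    using a by simp
  have l: "chain_map k g (?a i) = ?a (Suc i)" for i
    using chain_map_compose[of k g "g ^^ i"] by (simp only: funpow.simps comp_apply)
  have "chain_map k g (\<Sum>i<p. ?a i) - (\<Sum>i<p. ?a i) = (\<Sum>i<p. ?a (Suc i) - ?a i)"
    by (simp only: chain_map_sum finite_lessThan comp_def l sum_subtractf)
  also have "\<dots> = ?a p - ?a 0"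
    by (rule sum_lessThan_telescope)
  finally show "chain_map k g (\<Sum>i<p. ?a i) = (\<Sum>i<p. ?a i)"
    using a by simp
qed

lemma singular_chain_orbit_step:
  "singular_chain k X c \<Longrightarrow> continuous_map X X g \<Longrightarrow> singular_chain k X (orbit_step p g k c)"
  by (auto simp: orbit_step_def intro!: singular_chain_diff singular_chain_sum
      singular_chain_chain_map continuous_map_funpow)

text \<open>By these relations the next prescribed boundary is a cycle, so a resolution can be
  continued where homology vanishes.\<close>

lemma chain_boundary_orbit_step:
  assumes c: "singular_chain (Suc k) X d"
    and bd: "chain_boundary (Suc k) d = orbit_step p g k e" "singular_chain k X e"
    and per: "\<And>x. x \<in> topspace X \<Longrightarrow> (g ^^ p) x = x"
  shows "chain_boundary (Suc k) (orbit_step p g (Suc k) d) = 0"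
proof (cases "even k")
  case True
  have "chain_boundary (Suc k) (orbit_step p g (Suc k) d) =
      (\<Sum>i<p. chain_map k (g ^^ i) (chain_boundary (Suc k) d))"
    using True chain_boundary_chain_map[OF c, of "g ^^ i" for i] by (simp add: orbit_step_def chain_boundary_sum comp_def)
  also have "\<dots> = 0"
    using True orbit_step_sum_diff(1)[OF bd(2) per] by (simp add: bd(1) orbit_step_def)
  finally show ?thesis .
next
  case False
  have "chain_boundary (Suc k) (orbit_step p g (Suc k) d) =
      chain_map k g (chain_boundary (Suc k) d) - chain_boundary (Suc k) d"
    using False chain_boundary_chain_map[OF c, of g] by (simp add: orbit_step_def chain_boundary_diff)
  also have "\<dots> = 0"
    using False orbit_step_sum_diff(2)[OF bd(2) per] by (simp add: bd(1) orbit_step_def)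
  finally show ?thesis .
qed

subsection \<open>Resolutions of small simplices on the sphere\<close>

lemma cycle_is_boundary:
  assumes "trivial_group (homology_group (int k) X)"
    and z: "singular_chain k X z" "chain_boundary k z = 0"
  obtains d where "singular_chain (Suc k) X d" "chain_boundary (Suc k) d = z"
proof -
  have "singular_relcycle k X {} z"
    using z by (simp add: singular_cycle)
  then have "homologous_rel_set k X {} z \<in> carrier (homology_group (int k) X)"
    by (auto simp: carrier_relative_homology_group)
  then have "homologous_rel_set k X {} z = singular_relboundary_set k X {}"
    using assms(1) by (simp add: trivial_group_def)
  then have "singular_relboundary k X {} z"
    by (simp add: homologous_rel_set_eq_relboundary)
  then show thesis
    using that by (auto simp: singular_boundary)
qed

text \<open>The chains are built upwards. In degree \<open>0\<close> a point and its image under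
  \<open>g\<close> are homologous by path connectedness; afterwards the orbit step is a cycle in a
  degree below \<open>D\<close>, where homology is trivial.\<close>

lemma resolution_exists:
  assumes X: "path_connected_space X" "topspace X \<noteq> {}"
    and triv: "\<And>k. 0 < k \<Longrightarrow> k < D \<Longrightarrow> trivial_group (homology_group (int k) X)"
    and cont: "continuous_map X X g"
    and per: "\<And>x. x \<in> topspace X \<Longrightarrow> (g ^^ p) x = x"
  shows "\<exists>c. resolution p g X D c"
proof -
  obtain x where x: "x \<in> topspace X" using X(2) by blast
  define f where "f = restrict (\<lambda>_. x) (standard_simplex 0)"
  have f: "singular_simplex 0 X f"
    using x by (simp add: singular_simplex_def f_def)
  have "\<exists>c. resolution p g X n c \<and> c 0 = frag_of f" if "n \<le> D" for n
    using that
  proof (induction n)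
    case 0
    then show ?case
      using f by (intro exI[of _ "\<lambda>_. frag_of f"]) (simp add: resolution_def singular_chain_of)
  next
    case (Suc n)
    then obtain c where c: "resolution p g X n c" "c 0 = frag_of f" by auto
    let ?z = "orbit_step p g n (c n)"
    have cn: "singular_chain n X (c n)" using c by (simp add: resolution_def)
    have z: "singular_chain n X ?z"
      by (rule singular_chain_orbit_step[OF cn cont])
    have "\<exists>d. singular_chain (Suc n) X d \<and> chain_boundary (Suc n) d = ?z"
    proof (cases n)
      case 0
      have "homologous_rel 0 X {} (frag_of (simplex_map 0 g f)) (frag_of f)"
        by (intro iso_integer_zeroth_homology_group_aux X f singular_simplex_simplex_map[OF f cont])
      then show ?thesis
        using 0 c by (simp add: orbit_step_def homologous_rel_def singular_boundary)
    next
      case (Suc k)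
      have "chain_boundary n ?z = 0"
        unfolding Suc
        by (rule chain_boundary_orbit_step[where X = X and e = "c k"])
           (use c Suc per in \<open>auto simp: resolution_def\<close>)
      then show ?thesis
        using cycle_is_boundary[OF triv z] Suc Suc.prems by (metis Suc_le_eq zero_less_Suc)
    qed
    then obtain d where d: "singular_chain (Suc n) X d" "chain_boundary (Suc n) d = ?z" by blast
    have "resolution p g X (Suc n) (c(Suc n := d))"
      using c(1) d by (auto simp: resolution_def le_Suc_eq less_Suc_eq)
    moreover have "(c(Suc n := d)) 0 = frag_of f"
      using c(2) by simp
    ultimately show ?case by blast
  qed
  then show ?thesis by blast
qed

lemma singular_subdivision_sum:
  "singular_subdivision k (sum c I) = (\<Sum>i\<in>I. singular_subdivision k (c i))"
  by (induction I rule: infinite_finite_induct) (simp_all add: singular_subdivision_add)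

lemma singular_subdivision_orbit_step:
  assumes "singular_chain k X c"
  shows "singular_subdivision k (orbit_step p g k c) = orbit_step p g k (singular_subdivision k c)"
  using naturality_singular_subdivision[OF assms, of g]
    naturality_singular_subdivision[OF assms, of "g ^^ i" for i]
  by (simp add: orbit_step_def singular_subdivision_diff singular_subdivision_sum)

text \<open>Subdivision is a natural chain map, so it commutes with the boundary and the orbit step;
  in degree \<open>0\<close> it is the identity, which keeps the augmentation at
  \<open>1\<close>.\<close>

lemma resolution_subdivision:
  assumes "resolution p g X D c"
  shows "resolution p g X D (\<lambda>k. (singular_subdivision k ^^ n) (c k))"
proof (induction n)
  case 0
  then show ?case using assms by simp
next
  case (Suc n)
  then have ch: "singular_chain k X ((singular_subdivision k ^^ n) (c k))" if "k \<le> D" for k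
    using that by (simp add: resolution_def)
  show ?case
    using Suc
    by (auto simp: resolution_def singular_chain_singular_subdivision singular_subdivision_zero
        chain_boundary_singular_subdivision[OF ch] singular_subdivision_orbit_step[OF ch])
qed

lemma small_resolution_exists:
  assumes res: "resolution p g X D c"
    and \<C>: "\<And>V. V \<in> \<C> \<Longrightarrow> openin X V" "topspace X \<subseteq> \<Union>\<C>"
  shows "\<exists>c. resolution p g X D c \<and>
    (\<forall>k\<le>D. \<forall>f\<in>Poly_Mapping.keys (c k). \<exists>V\<in>\<C>. f \<in> standard_simplex k \<rightarrow> V)"
proof -
  have "\<exists>n. \<forall>m\<ge>n. \<forall>f\<in>Poly_Mapping.keys ((singular_subdivision k ^^ m) (c k)).
      \<exists>V\<in>\<C>. f \<in> standard_simplex k \<rightarrow> V" if "k \<le> D" for k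
    using sufficient_iterated_singular_subdivision_exists[OF \<C>, of k "c k"] res that
    by (metis resolution_def)
  then obtain n where n: "\<And>k m f. k \<le> D \<Longrightarrow> n k \<le> m \<Longrightarrow>
      f \<in> Poly_Mapping.keys ((singular_subdivision k ^^ m) (c k)) \<Longrightarrow>
      \<exists>V\<in>\<C>. f \<in> standard_simplex k \<rightarrow> V"
    by metis
  \<comment> \<open>All degrees must be subdivided equally often to preserve the boundary relations,
    hence a maximum over \<open>k \<le> D\<close>.\<close>
  have "n k \<le> Max (n ` {..D})" if "k \<le> D" for k
    using that by simp
  then show ?thesis
    using n resolution_subdivision[OF res, of "Max (n ` {..D})"] by blast
qed

section \<open>Homology and connectedness of the unit sphere\<close>

lemma trivial_homology_sphere:
  assumes "k \<noteq> 0" "Suc k \<noteq> DIM('a::euclidean_space)"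
  shows "trivial_group (homology_group (int k) (top_of_set (sphere (0::'a) 1)))"
proof -
  obtain f :: "(nat \<Rightarrow> real) \<Rightarrow> 'a" and g
    where "homeomorphic_maps (nsphere (DIM('a) - 1)) (top_of_set (sphere 0 1 \<inter> span Basis)) f g"
    by (rule homeomorphic_maps_nsphere_euclidean_sphere[of "Basis :: 'a set"])
       (auto simp: independent_Basis pairwise_def orthogonal_def inner_not_same_Basis)
  then have "nsphere (DIM('a) - 1) homeomorphic_space top_of_set (sphere (0::'a) 1)"
    by (auto simp: homeomorphic_space_def)
  then have iso: "homology_group (int k) (nsphere (DIM('a) - 1)) \<cong>
      homology_group (int k) (top_of_set (sphere (0::'a) 1))"
    by (rule homeomorphic_space_imp_isomorphic_homology_groups)
  have "int k \<noteq> int (DIM('a) - 1)"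
    using assms(2) DIM_positive[where 'a = 'a] by linarith
  then have "trivial_group (homology_group (int k) (nsphere (DIM('a) - 1)))"
    using assms(1) trivial_reduced_homology_group_nsphere un_reduced_homology_group
    by (metis of_nat_eq_0_iff)
  then show ?thesis
    using isomorphic_group_triviality[OF iso] by simp
qed

lemma path_connected_space_sphere:
  assumes "2 \<le> DIM('a::euclidean_space)"
  shows "path_connected_space (top_of_set (sphere (0::'a) 1))"
proof -
  have "path_connected (sphere (0::'a) 1)"
    by (rule path_connected_sphere) (use assms in simp)
  show ?thesis
    unfolding path_connected_space_def
  proof (intro ballI)
    fix x y :: 'a
    assume "x \<in> topspace (top_of_set (sphere 0 1))" "y \<in> topspace (top_of_set (sphere 0 1))"
    then obtain h where "path h" "path_image h \<subseteq> sphere 0 1" "pathstart h = x" "pathfinish h = y"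
      using \<open>path_connected (sphere (0::'a) 1)\<close> unfolding path_connected_def topspace_euclidean_subtopology by blast
    then show "\<exists>h. pathin (top_of_set (sphere 0 1)) h \<and> h 0 = x \<and> h 1 = y"
      by (intro exI[of _ h])
         (auto simp: pathin_def path_def path_image_def pathstart_def pathfinish_def
           continuous_map_in_subtopology)
  qed
qed

subsection \<open>Equivariant labels\<close>

lemma funpow_eq_mod:
  assumes "(T ^^ p) l = l" "a mod p = b mod p"
  shows "(T ^^ a) l = (T ^^ b) l"
  using assms by (metis funpow_mod_eq)

text \<open>On a free orbit an equivariant map may be prescribed at one point: choose a
  representative and an admissible label there, and transport the label along the powers of
  \<open>g\<close>.\<close>

lemma equivariant_selection:
  fixes g :: "'a \<Rightarrow> 'a" and T :: "'l \<Rightarrow> 'l"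
  assumes g: "\<And>x. x \<in> X \<Longrightarrow> g x \<in> X"
    and per: "\<And>x. x \<in> X \<Longrightarrow> (g ^^ p) x = x"
    and free: "\<And>x i. x \<in> X \<Longrightarrow> 0 < i \<Longrightarrow> i < p \<Longrightarrow> (g ^^ i) x \<noteq> x"
    and p: "0 < p"
    and ex: "\<And>x. x \<in> X \<Longrightarrow> \<exists>l. Q x l"
    and step: "\<And>x l. x \<in> X \<Longrightarrow> Q x l \<Longrightarrow> Q (g x) (T l)"
    and perT: "\<And>x l. x \<in> X \<Longrightarrow> Q x l \<Longrightarrow> (T ^^ p) l = l"
  shows "\<exists>L. \<forall>x\<in>X. Q x (L x) \<and> L (g x) = T (L x)"
proof -
  have gX: "(g ^^ n) x \<in> X" if "x \<in> X" for n x
    by (induction n) (simp_all add: that g)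
  \<comment> \<open>Freeness determines the exponent along an orbit modulo \<open>p\<close>, so the
    arbitrary choice of \<open>k x\<close> below is harmless.\<close>
  have same: "a mod p = b mod p" if "x \<in> X" "(g ^^ a) x = (g ^^ b) x" for x a b
    using that(2)
  proof (induction a b rule: linorder_wlog)
    case (le a b)
    have "(g ^^ (b - a)) ((g ^^ a) x) = (g ^^ a) x"
      using le by (metis comp_apply funpow_add le_add_diff_inverse2)
    then have "(g ^^ ((b - a) mod p)) ((g ^^ a) x) = (g ^^ a) x"
      using funpow_mod_eq[OF per[OF gX[OF that(1)]]] by metis
    then have "(b - a) mod p = 0"
      using free[OF gX[OF that(1)]] p by (metis gr0I mod_less_divisor)
    then show ?case
      using le(1) by (metis mod_eq_dvd_iff_nat mod_0_imp_dvd)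
  qed simp
  define orb where "orb x = {(g ^^ n) x | n. True}" for x
  have orb_g: "orb (g x) = orb x" if "x \<in> X" for x
  proof -
    have "(g ^^ n) (g x) \<in> orb x" for n
      by (auto simp: orb_def simp flip: funpow_swap1 intro: exI[of _ "Suc n"])
    moreover have "(g ^^ n) x = (g ^^ (n + (p - 1))) (g x)" for n
    proof -
      have "(g ^^ (n + (p - 1))) (g x) = (g ^^ n) ((g ^^ Suc (p - 1)) x)"
        by (simp add: funpow_add funpow_swap1)
      then show ?thesis using p per[OF that] by simp
    qed
    then have "(g ^^ n) x \<in> orb (g x)" for n
      by (auto simp: orb_def)
    ultimately show ?thesis
      unfolding orb_def by blast
  qed
  \<comment> \<open>Chosen from the orbit as a set, hence common to all its points.\<close>
  define r where "r x = (SOME y. y \<in> orb x)" for x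
  have r: "r x \<in> orb x" for x
    unfolding r_def by (rule someI[of _ "(g ^^ 0) x"]) (auto simp: orb_def intro: exI[of _ 0])
  have rX: "r x \<in> X" if "x \<in> X" for x
    using r[of x] gX[OF that] by (auto simp: orb_def)
  have r_ex: "\<exists>k. (g ^^ k) (r x) = x" if "x \<in> X" for x
  proof -
    obtain n where n: "r x = (g ^^ n) x" using r[of x] by (auto simp: orb_def)
    \<comment> \<open>A natural number representing \<open>- n\<close> modulo
      \<open>p\<close>.\<close>
    have "(g ^^ (n * p - n)) (r x) = (g ^^ (n * p)) x"
      unfolding n using p by (simp flip: funpow_add comp_apply[of "g ^^ _" "g ^^ _"])
    also have "\<dots> = (g ^^ 0) x"
      by (rule funpow_eq_mod[OF per[OF that]]) simp
    finally show ?thesis by auto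
  qed
  define k where "k x = (SOME k. (g ^^ k) (r x) = x)" for x
  have k: "(g ^^ k x) (r x) = x" if "x \<in> X" for x
    unfolding k_def by (rule someI_ex[OF r_ex[OF that]])
  define s where "s x = (SOME l. Q x l)" for x
  have s: "Q x (s x)" if "x \<in> X" for x
    unfolding s_def by (rule someI_ex[OF ex[OF that]])
  define L where "L x = (T ^^ k x) (s (r x))" for x
  have "Q ((g ^^ n) x) ((T ^^ n) l)" if "x \<in> X" "Q x l" for n x l
    by (induction n) (simp_all add: that step gX)
  from this[OF rX s[OF rX]] k have "Q x (L x)" if "x \<in> X" for x
    using that by (metis L_def)
  moreover have "L (g x) = T (L x)" if "x \<in> X" for x
  proof -
    have r_eq: "r (g x) = r x"
      by (simp add: r_def orb_g[OF that])
    have "(g ^^ k (g x)) (r x) = (g ^^ Suc (k x)) (r x)"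
      using k[OF g[OF that]] k[OF that] by (simp add: r_eq)
    then have "k (g x) mod p = Suc (k x) mod p"
      by (rule same[OF rX[OF that]])
    then have "(T ^^ k (g x)) (s (r x)) = (T ^^ Suc (k x)) (s (r x))"
      by (rule funpow_eq_mod[OF perT[OF rX[OF that] s[OF rX[OF that]]]])
    then show ?thesis by (simp add: L_def r_eq)
  qed
  ultimately show ?thesis by blast
qed

section \<open>Label sets and their cyclic rotation\<close>

definition rot :: "nat \<Rightarrow> nat \<Rightarrow> nat" where
  "rot p j = Suc j mod p"

definition rot_label :: "nat \<Rightarrow> nat \<times> nat \<Rightarrow> nat \<times> nat" where
  "rot_label p l = (fst l, rot p (snd l))"

definition fibre :: "(nat \<times> nat) set \<Rightarrow> nat \<Rightarrow> nat set" where
  "fibre S i = {j. (i, j) \<in> S}"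

text \<open>The simplices of the join of \<open>t\<close> copies of the boundary of a
  \<open>(p - 1)\<close>-simplex.\<close>

definition small_labels :: "nat \<Rightarrow> nat \<Rightarrow> (nat \<times> nat) set \<Rightarrow> bool" where
  "small_labels t p S \<longleftrightarrow> S \<noteq> {} \<and> S \<subseteq> {1..t} \<times> {..<p} \<and> (\<forall>i. fibre S i \<noteq> {..<p})"

text \<open>The mean of $A$ modulo $p$, which moves by one when $A$ does. The \<open>SOME\<close> is meaningful only if
$p$ does not divide the size of $A$, which is where primality of $p$ enters.\<close>

definition barycentre :: "nat \<Rightarrow> nat set \<Rightarrow> nat" where
  "barycentre p A = (SOME b. [card A * b = 1] (mod p)) * \<Sum>A mod p"

text \<open>Rotation preserves which fibres are nonempty, so the least one is an equivariant choice
  of a proper nonempty subset of \<open>Z_p\<close>.\<close>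

definition shift_index :: "nat \<Rightarrow> (nat \<times> nat) set \<Rightarrow> nat" where
  "shift_index p S = barycentre p (fibre S (LEAST i. fibre S i \<noteq> {}))"

lemma rot_label_funpow:
  assumes "snd l < p"
  shows "(rot_label p ^^ n) l = (fst l, (snd l + n) mod p)"
  by (induction n) (use assms in \<open>auto simp: rot_label_def rot_def mod_Suc_eq\<close>)

lemma inj_on_rot: "inj_on (rot p) {..<p}"
  by (rule inj_onI) (auto simp: rot_def mod_Suc split: if_splits)

lemma fibre_image: "fibre (rot_label p ` S) i = rot p ` fibre S i"
  by (force simp: fibre_def rot_label_def)

text \<open>Rotation adds \<open>card A\<close> to the sum modulo \<open>p\<close>, and multiplying
  by the inverse of \<open>card A\<close> turns this into \<open>1\<close>. The inverse exists
  because \<open>0 < card A < p\<close> and \<open>p\<close> is prime.\<close>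

lemma barycentre_rot:
  assumes p: "prime p" and A: "A \<subseteq> {..<p}" "A \<noteq> {}" "A \<noteq> {..<p}"
  shows "barycentre p (rot p ` A) = Suc (barycentre p A) mod p"
proof -
  have fin: "finite A" using A(1) finite_subset by blast
  have inj: "inj_on (rot p) A" using inj_on_rot A(1) by (rule inj_on_subset)
  have "card A < p"
    using A psubset_card_mono[of "{..<p}" A] by auto
  moreover have "0 < card A" using A(2) fin by (simp add: card_gt_0_iff)
  ultimately have "\<not> p dvd card A" by (auto dest: dvd_imp_le)
  then have "coprime (card A) p"
    using p by (simp add: coprime_commute prime_imp_coprime)
  then have ex: "\<exists>b. [card A * b = 1] (mod p)"
    using cong_solve_coprime_nat by simp
  define b where "b = (SOME b. [card A * b = 1] (mod p))"
  have b: "[card A * b = 1] (mod p)"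
    unfolding b_def by (rule someI_ex[OF ex])
  have "\<Sum>(rot p ` A) = (\<Sum>j\<in>A. rot p j)"
    using inj by (simp add: sum.reindex)
  moreover have "[(\<Sum>j\<in>A. rot p j) = (\<Sum>j\<in>A. Suc j)] (mod p)"
    by (rule cong_sum) (simp add: rot_def cong_def)
  moreover have "(\<Sum>j\<in>A. Suc j) = \<Sum>A + card A"
    using sum.distrib[of "\<lambda>j. j" "\<lambda>_. 1" A] by simp
  ultimately have "[b * \<Sum>(rot p ` A) = b * (\<Sum>A + card A)] (mod p)"
    by (metis cong_mult cong_refl)
  also have "[b * (\<Sum>A + card A) = b * \<Sum>A + 1] (mod p)"
    using b by (simp only: distrib_left) (intro cong_add cong_refl, simp add: mult.commute)
  finally have "[b * \<Sum>(rot p ` A) = b * \<Sum>A + 1] (mod p)" .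
  then show ?thesis
    unfolding barycentre_def card_image[OF inj] b_def[symmetric] by (simp add: cong_def mod_Suc_eq)
qed

text \<open>Each of the \<open>t\<close> fibres misses at least one of \<open>p\<close>
  elements.\<close>

lemma card_small_labels:
  assumes "small_labels t p S"
  shows "card S \<le> t * (p - 1)"
proof -
  have S: "S = (SIGMA i:{1..t}. fibre S i)" and fib: "fibre S i \<subset> {..<p}" for i
    using assms by (auto simp: small_labels_def fibre_def)
  have fin: "finite (fibre S i)" for i
    using fib[of i] by (meson finite_lessThan finite_subset psubset_imp_subset)
  have "card (fibre S i) \<le> p - 1" for i
    using psubset_card_mono[OF _ fib[of i]] by simp
  then have "(\<Sum>i\<in>{1..t}. card (fibre S i)) \<le> of_nat (card {1..t}) * (p - 1)"
    by (intro sum_bounded_above)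
  then have "card (SIGMA i:{1..t}. fibre S i) \<le> t * (p - 1)"
    using fin by (simp add: card_SigmaI)
  then show ?thesis
    using S by simp
qed

lemma free_labelling_rot:
  assumes p: "prime p"
  shows "free_labelling p (rot_label p) (small_labels t p) (shift_index p)"
proof
  have p0: "0 < p" using p prime_gt_0_nat by blast
  fix S
  assume S: "small_labels t p S"
  have fib: "fibre S i \<subseteq> {..<p}" "fibre S i \<noteq> {..<p}" for i
    using S by (auto simp: small_labels_def fibre_def)
  have inj: "inj_on (rot p) (fibre S i)" for i
    using inj_on_rot fib(1) by (rule inj_on_subset)
  have "rot p ` fibre S i \<noteq> {..<p}" for i
  proof -
    have "card (fibre S i) < p"
      using psubset_card_mono[of "{..<p}" "fibre S i"] fib[of i] by auto
    then have "card (rot p ` fibre S i) \<noteq> card {..<p}"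
      by (simp add: card_image[OF inj])
    then show ?thesis by metis
  qed
  then show "small_labels t p (rot_label p ` S)"
    using S p0 by (auto simp: small_labels_def fibre_image) (auto simp: rot_label_def rot_def)
  show "shift_index p S < p"
    using p0 by (simp add: shift_index_def barycentre_def)
  show "shift_index p (rot_label p ` S) = Suc (shift_index p S) mod p"
  proof -
    have "\<exists>i. fibre S i \<noteq> {}"
      using S by (auto simp: small_labels_def fibre_def)
    then have "fibre S (LEAST i. fibre S i \<noteq> {}) \<noteq> {}"
      by (rule LeastI_ex)
    then show ?thesis
      unfolding shift_index_def fibre_image image_is_empty
      by (intro barycentre_rot p fib)
  qed
  show "(rot_label p ^^ p) x = x" if "x \<in> S" for x
  proof -
    have "snd x < p" using S that by (auto simp: small_labels_def)
    then show ?thesis by (simp add: rot_label_funpow prod_eq_iff)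
  qed
  show "small_labels t p S'" if "S' \<subseteq> S" "S' \<noteq> {}" for S'
  proof -
    have "fibre S' i \<subset> {..<p}" for i
      using that(1) fib[of i] by (auto simp: fibre_def)
    then show ?thesis
      using S that unfolding small_labels_def by blast
  qed
qed

subsection \<open>The orbit theorem\<close>

lemma norm_vector_scalar_mult: "norm (c *s x) = cmod c * norm (x :: complex ^ 'n)"
  by (simp add: norm_vec_def L2_set_right_distrib norm_mult)

lemma zeta_power: "zeta p ^ k = cis (2 * pi * real k / real p)"
proof -
  have "zeta p = cis (2 * pi / real p)"
    by (simp add: zeta_def cis_conv_exp mult_ac)
  then show ?thesis by (simp add: Complex.DeMoivre mult_ac)
qed

lemma zeta_power_eq_1:
  assumes "0 < p"
  shows "zeta p ^ p = 1"
  using assms by (simp add: zeta_power)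

lemma zeta_power_neq_1:
  assumes "0 < i" "i < p"
  shows "zeta p ^ i \<noteq> 1"
proof
  assume "zeta p ^ i = 1"
  then have "cos (2 * pi * real i / real p) = 1"
    by (simp add: zeta_power complex_eq_iff)
  then obtain n :: int where "2 * pi * real i / real p = real_of_int n * 2 * pi"
    by (auto simp: cos_one_2pi_int)
  then have "real i = real_of_int n * real p"
    using assms by (simp add: field_simps)
  then have "int i = n * int p"
    by (metis of_int_eq_iff of_int_mult of_int_of_nat_eq)
  then have "int p dvd int i" by simp
  then show False
    using assms by (auto dest: dvd_imp_le)
qed

lemma Lebesgue_number_finite:
  fixes V :: "'i \<Rightarrow> 'j \<Rightarrow> 'a::metric_space set"
  assumes "compact S" "finite I"
    and "\<And>i j. i \<in> I \<Longrightarrow> j \<in> J \<Longrightarrow> open (V i j)"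
    and "\<And>i. i \<in> I \<Longrightarrow> S \<subseteq> (\<Union>j\<in>J. V i j)"
  obtains e where "0 < e" "\<And>i x. i \<in> I \<Longrightarrow> x \<in> S \<Longrightarrow> \<exists>j\<in>J. ball x e \<subseteq> V i j"
proof -
  have "\<exists>e>0. \<forall>x\<in>S. \<exists>j\<in>J. ball x e \<subseteq> V i j" if i: "i \<in> I" for i
  proof -
    have "\<exists>e>0. \<forall>x\<in>S. \<exists>G\<in>V i ` J. ball x e \<subseteq> G"
      by (rule Heine_Borel_lemma[OF assms(1)]) (use assms(3,4)[OF i] in auto)
    then show ?thesis by simp
  qed
  then obtain e where e: "\<forall>i\<in>I. 0 < e i \<and> (\<forall>x\<in>S. \<exists>j\<in>J. ball x (e i) \<subseteq> V i j)"
    by metis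
  \<comment> \<open>The inserted \<open>1\<close> covers an empty \<open>I\<close>.\<close>
  define d where "d = Min (insert 1 (e ` I))"
  have "0 < d"
    using assms(2) e by (auto simp: d_def)
  moreover have "\<exists>j\<in>J. ball x d \<subseteq> V i j" if "i \<in> I" "x \<in> S" for i x
  proof -
    have "d \<le> e i" using assms(2) that by (auto simp: d_def)
    then have "ball x d \<subseteq> ball x (e i)" by (simp add: subset_ball)
    then show ?thesis using e that by (meson subset_trans)
  qed
  ultimately show thesis by (rule that)
qed

theorem theorem2p1:
  fixes p t :: nat
    and U :: "nat \<Rightarrow> (complex ^ 'n) set"
  assumes "prime p" and "odd p"
    and "t \<ge> 1"
    and "t * (p - 1) < 2 * CARD('n)"
    and "\<And>i. i \<in> {1..t+1} \<Longrightarrow> closed (U i)"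
    and "\<And>i. i \<in> {1..t+1} \<Longrightarrow> U i \<subseteq> sphere 0 1"
    and "sphere 0 1 \<subseteq> (\<Union>i\<in>{1..t+1}. U i)"
  shows "\<exists>i\<in>{1..t+1}. \<exists>x\<in>sphere (0 :: complex ^ 'n) 1. orbit p x \<subseteq> U i"
proof (rule ccontr)
  assume contra: "\<not> ?thesis"
  define S where "S = sphere (0 :: complex ^ 'n) 1"
  define g where "g x = zeta p *s x" for x :: "complex ^ 'n"
  define D where "D = t * (p - 1)"
  have p: "1 < p" using assms(1) prime_gt_1_nat by blast
  interpret free_labelling p "rot_label p" "small_labels t p" "shift_index p"
    by (rule free_labelling_rot[OF assms(1)])
  have g_pow: "(g ^^ k) x = zeta p ^ k *s x" for k x
    by (induction k) (simp_all add: g_def vec_eq_iff mult.assoc)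
  have norm_g: "norm (g x) = norm x" for x
    using zeta_power[of p 1] by (simp add: g_def norm_vector_scalar_mult)
  have gS: "g x \<in> S" if "x \<in> S" for x
    using that by (simp add: S_def norm_g)
  have dist_g: "dist (g x) (g y) = dist x y" for x y
  proof -
    have "g x - g y = g (x - y)" by (simp add: g_def vec_eq_iff right_diff_distrib)
    then show ?thesis by (simp add: dist_norm norm_g)
  qed
  have g_powS: "(g ^^ k) x \<in> S" if "x \<in> S" for k x
    by (induction k) (simp_all add: that gS)
  have per: "(g ^^ p) x = x" for x
    using p by (simp add: g_pow zeta_power_eq_1)
  have free: "(g ^^ i) x \<noteq> x" if "x \<in> S" "0 < i" "i < p" for x i
  proof
    assume "(g ^^ i) x = x"
    then have "(zeta p ^ i - 1) *s x = 0"
      by (simp add: g_pow vec_eq_iff left_diff_distrib)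
    then have "cmod (zeta p ^ i - 1) * norm x = 0"
      by (metis norm_vector_scalar_mult norm_zero)
    then show False
      using that zeta_power_neq_1[of i p] by (simp add: S_def)
  qed
  have cont_pow: "continuous_on UNIV (g ^^ k)" for k
    unfolding g_pow[abs_def] vector_scalar_mult_def by (intro continuous_intros)
  have orbit_eq: "orbit p x = {(g ^^ k) x | k. k < p}" for x
    by (simp add: orbit_def g_pow)

  \<comment> \<open>For each \<open>i \<le> t\<close> these open sets cover the sphere, as no orbit
    lies in \<open>U i\<close>. The last set \<open>U (t + 1)\<close> provides no labels, which
    leaves only \<open>t\<close> fibres.\<close>
  define V where "V i j = {x. (g ^^ j) x \<notin> U i}" for i j
  have V_open: "open (V i j)" if "i \<in> {1..t}" for i j
  proof -
    have "open ((g ^^ j) -` (- U i))"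
      using assms(5)[of i] that cont_pow by (intro open_vimage) auto
    then show ?thesis by (simp add: V_def vimage_def)
  qed
  have V_cover: "S \<subseteq> (\<Union>j\<in>{..<p}. V i j)" if "i \<in> {1..t}" for i
  proof
    fix x assume "x \<in> S"
    then have "\<not> orbit p x \<subseteq> U i"
      using contra that by (auto simp: S_def)
    then show "x \<in> (\<Union>j\<in>{..<p}. V i j)"
      by (auto simp: orbit_eq V_def)
  qed
  have "compact S" by (simp add: S_def)
  obtain e where e: "0 < e"
      "\<And>i x. i \<in> {1..t} \<Longrightarrow> x \<in> S \<Longrightarrow> \<exists>j\<in>{..<p}. ball x e \<subseteq> V i j"
    using Lebesgue_number_finite[of S "{1..t}" "{..<p}" V, OF \<open>compact S\<close> _ V_open V_cover]
    by (metis finite_atLeastAtMost)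
  \<comment> \<open>The exponent \<open>p - snd l\<close> stands for \<open>- snd l\<close>, so that passing from \<open>x\<close> to \<open>g x\<close> increases the label.\<close>
  define Q where "Q x l \<longleftrightarrow> fst l \<in> {1..t} \<and> snd l < p \<and> (\<exists>k. (g ^^ k) x \<in> U (fst l)) \<and>
      (\<forall>y\<in>S. dist x y < e \<longrightarrow> (g ^^ (p - snd l)) y \<notin> U (fst l))" for x and l :: "nat \<times> nat"
  have Q_ex: "\<exists>l. Q x l" if xS: "x \<in> S" for x
  proof -
    \<comment> \<open>An orbit avoiding the first \<open>t\<close> sets would lie in
      \<open>U (t + 1)\<close>.\<close>
    have "\<exists>i\<in>{1..t}. \<exists>k. (g ^^ k) x \<in> U i"
    proof (rule ccontr)
      assume none: "\<not> ?thesis"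
      have "(g ^^ k) x \<in> U (t + 1)" for k
      proof -
        obtain i where i: "i \<in> {1..t + 1}" "(g ^^ k) x \<in> U i"
          using assms(7) g_powS[OF xS, of k] unfolding S_def by blast
        with none have "i \<notin> {1..t}" by blast
        with i have "i = t + 1" by simp
        with i show ?thesis by simp
      qed
      then have "orbit p x \<subseteq> U (t + 1)"
        unfolding orbit_eq by blast
      moreover have "t + 1 \<in> {1..t + 1}" by simp
      ultimately show False
        using contra that unfolding S_def by blast
    qed
    then obtain i k where i: "i \<in> {1..t}" "(g ^^ k) x \<in> U i" by blast
    obtain j where j: "j < p" "ball x e \<subseteq> V i j"
      using e(2)[OF i(1) xS] by blast
    \<comment> \<open>The label is \<open>- j\<close> modulo \<open>p\<close>, so \<open>p\<close>
      minus it is \<open>j\<close> again; for \<open>j = 0\<close> it is \<open>p\<close>, which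
      \<open>per\<close> turns into the identity.\<close>
    have "(g ^^ (p - (if j = 0 then 0 else p - j))) y \<notin> U i" if "dist x y < e" for y
      using j that per by (auto simp: V_def subset_iff)
    then have "Q x (i, if j = 0 then 0 else p - j)"
      using i j p by (auto simp: Q_def)
    then show ?thesis by blast
  qed
  have Q_step: "Q (g x) (rot_label p l)" if Qx: "Q x l" for x l
  proof -
    obtain i j where l: "l = (i, j)" by (cases l)
    have j: "j < p" and i: "i \<in> {1..t}" and Q: "\<And>y. y \<in> S \<Longrightarrow> dist x y < e \<Longrightarrow> (g ^^ (p - j)) y \<notin> U i"
      using Qx by (auto simp: Q_def l)
    obtain k where "(g ^^ k) x \<in> U i"
      using Qx by (auto simp: Q_def l)
    moreover have "(g ^^ (k + (p - 1))) (g x) = (g ^^ k) ((g ^^ Suc (p - 1)) x)"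
      by (simp add: funpow_add funpow_swap1)
    ultimately have "(g ^^ (k + (p - 1))) (g x) \<in> U i"
      using p per by simp
    moreover have "(g ^^ (p - rot p j)) y \<notin> U i" if "y \<in> S" "dist (g x) y < e" for y
    proof -
      \<comment> \<open>The preimage of \<open>y\<close> under \<open>g\<close>; as \<open>g\<close>
        is an isometry, \<open>z\<close> is as near to \<open>x\<close> as \<open>y\<close> is to
        \<open>g x\<close>, and the condition at \<open>x\<close> applies.\<close>
      define z where "z = (g ^^ (p - 1)) y"
      have gz: "g z = y"
        using per[of y] p by (cases p) (auto simp: z_def)
      have "(g ^^ (p - j)) z \<notin> U i"
        by (rule Q) (use that g_powS[of y "p - 1"] dist_g[of x z] gz in \<open>auto simp: z_def\<close>)
      moreover have "(g ^^ (p - rot p j)) (g z) = (g ^^ (p - j)) z"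
      proof (cases "Suc j = p")
        case True
        \<comment> \<open>At the wrap-around the exponent is \<open>p\<close> and acts as the
          identity, leaving the single \<open>g\<close> in \<open>g z\<close>.\<close>
        then have "rot p j = 0" "p - j = 1" by (auto simp: rot_def)
        then show ?thesis using per[of "g z"] by simp
      next
        case False
        then have "rot p j = Suc j" "p - j = Suc (p - Suc j)" using j by (auto simp: rot_def)
        then show ?thesis by (simp add: funpow_swap1)
      qed
      ultimately show ?thesis using gz by simp
    qed
    ultimately show ?thesis
      using i p by (auto simp: Q_def l rot_label_def rot_def)
  qed
  have "\<exists>L. \<forall>x\<in>S. Q x (L x) \<and> L (g x) = rot_label p (L x)"
  proof (rule equivariant_selection[where p = p])
    show "(rot_label p ^^ p) l = l" if "Q x l" for x l
      using that by (cases l) (simp add: Q_def rot_label_funpow)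
  qed (use gS per free p Q_ex Q_step in auto)
  then obtain L where L: "\<And>x. x \<in> S \<Longrightarrow> Q x (L x)" "\<And>x. x \<in> S \<Longrightarrow> L (g x) = rot_label p (L x)"
    by blast

  have small: "small_labels t p (L ` W)"
    if W: "W \<noteq> {}" "W \<subseteq> S" "\<And>x y. x \<in> W \<Longrightarrow> y \<in> W \<Longrightarrow> dist x y < e" for W
  proof -
    have "fibre (L ` W) i \<noteq> {..<p}" for i
    proof
      \<comment> \<open>The label \<open>(i, 0)\<close> yields a point \<open>x\<close> of
        \<open>W\<close> with \<open>(g ^^ k) x\<close> in \<open>U i\<close> for some
        \<open>k\<close>. The label with second entry \<open>- k\<close> modulo \<open>p\<close>
        also occurs, at some \<open>y\<close>, and forbids exactly this for all points of the sphere
        near \<open>y\<close>, in particular for \<open>x\<close>.\<close>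
      assume full: "fibre (L ` W) i = {..<p}"
      then have ex: "\<exists>x\<in>W. L x = (i, j)" if "j < p" for j
      proof -
        have "j \<in> fibre (L ` W) i" using full that by simp
        then show ?thesis by (auto simp: fibre_def image_iff eq_commute)
      qed
      then obtain x where x: "x \<in> W" "L x = (i, 0)" using p by force
      then obtain k where k: "(g ^^ k) x \<in> U i"
        using L(1)[of x] W(2) by (auto simp: Q_def)
      define j where "j = (if k mod p = 0 then 0 else p - k mod p)"
      have "j < p" using p by (auto simp: j_def)
      then obtain y where y: "y \<in> W" "L y = (i, j)" using ex by blast
      then have "(g ^^ (p - j)) x \<notin> U i"
        using L(1)[of y] W(2) W(3)[OF y(1) x(1)] x(1) by (auto simp: Q_def)
      moreover have "(g ^^ (p - j)) x = (g ^^ k) x"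
        by (rule funpow_eq_mod[OF per]) (use p in \<open>auto simp: j_def\<close>)
      ultimately show False using k by simp
    qed
    moreover have "L x \<in> {1..t} \<times> {..<p}" if "x \<in> W" for x
      using L(1)[of x] W(2) that by (auto simp: Q_def mem_Times_iff)
    then have "L ` W \<subseteq> {1..t} \<times> {..<p}" by blast
    ultimately show ?thesis
      using W(1) unfolding small_labels_def by blast
  qed

  \<comment> \<open>Small chains on the sphere\<close>
  define X where "X = top_of_set S"
  have topX: "topspace X = S" by (simp add: X_def)
  have contX: "continuous_map X X g"
    using continuous_on_subset[OF cont_pow[of 1], of S] gS by (auto simp: X_def)
  have DIM: "DIM(complex ^ 'n) = 2 * CARD('n)"
    by simp
  have "\<exists>c. resolution p g X D c"
  proof (rule resolution_exists[OF _ _ _ contX])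
    show "path_connected_space X"
      unfolding X_def S_def by (rule path_connected_space_sphere) (simp add: DIM Suc_leI)
    show "topspace X \<noteq> {}"
      by (simp add: topX S_def)
    \<comment> \<open>From \<open>k < D\<close> and \<open>D < 2 * CARD('n)\<close> the degree is
      below the dimension of the sphere.\<close>
    show "trivial_group (homology_group (int k) X)" if "0 < k" "k < D" for k
      unfolding X_def S_def
      by (rule trivial_homology_sphere) (use that assms(4) DIM in \<open>auto simp: D_def\<close>)
  qed (rule per)
  then obtain c0 where c0: "resolution p g X D c0" by blast
  \<comment> \<open>Half of \<open>e\<close>, so that vertices of a simplex inside one ball are less
    than \<open>e\<close> apart, as \<open>small\<close> requires.\<close>
  define \<C> where "\<C> = (\<lambda>x. S \<inter> ball x (e / 2)) ` S"
  have C_open: "openin X W" if "W \<in> \<C>" for W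
    using that by (auto simp: \<C>_def X_def intro: openin_open_Int)
  have C_cover: "topspace X \<subseteq> \<Union>\<C>"
    using e(1) by (auto simp: topX \<C>_def)
  obtain c where c: "resolution p g X D c"
      "\<And>k f. k \<le> D \<Longrightarrow> f \<in> Poly_Mapping.keys (c k) \<Longrightarrow> \<exists>W\<in>\<C>. f \<in> standard_simplex k \<rightarrow> W"
    using small_resolution_exists[OF c0 C_open C_cover] by metis
  show False
  proof (rule no_small_resolution[OF p c(1) contX, of L])
    show "L (g x) = rot_label p (L x)" if "x \<in> topspace X" for x
      using L(2) that by (simp add: topX)
    show "card A \<le> D" if "small_labels t p A" for A
      using card_small_labels[OF that] by (simp add: D_def)
    show "small_labels t p (vertex_labels L f ` {..k})"
      if kf: "k \<le> D" "f \<in> Poly_Mapping.keys (c k)" for k f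
    proof -
      obtain x where x: "f \<in> standard_simplex k \<rightarrow> S \<inter> ball x (e / 2)"
        using c(2)[OF kf] by (auto simp: \<C>_def)
      let ?W = "(\<lambda>i. f (\<lambda>j. if j = i then 1 else 0)) ` {..k}"
      have W: "?W \<subseteq> S \<inter> ball x (e / 2)"
        using x by auto
      have "small_labels t p (L ` ?W)"
      proof (rule small)
        show "dist y z < e" if "y \<in> ?W" "z \<in> ?W" for y z
        proof -
          have "dist x y < e / 2" "dist x z < e / 2"
            using W that by (auto simp: subset_iff)
          then show ?thesis by (rule dist_triangle_half_r)
        qed
      qed (use W in auto)
      moreover have "L ` ?W = vertex_labels L f ` {..k}"
        by (simp add: image_image vertex_labels_def)
      ultimately show ?thesis by simp
    qed
  qed
qed

end
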